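(* Let $A=(\{S_n\},\{\mathcal P_n^c\};k)$ be a Ramsey-type problem with Ramsey-type number $R(A)$. For each $n$, consider the following system over $\overline{\mathbb{F}_2}$ in variables $x_{c,s}$, $1\le c\le k$, $s\in S_n$: \begin{align*} p_{X,c}:=\prod_{s \in X} x_{c,s} &=0 &&\forall X \in \mathcal P_n^c,\ 1\le c \le k,\\ q_s:=1+\sum_{i=1}^k x_{i,s}&= 0 &&\forall s \in S_n,\\ u_{i,j,s}:=x_{i,s}x_{j,s} & = 0 &&\forall s\in S_n,\ \forall i,j,\ 1\le i<j\le k. \end{align*} Then for each $n$, $R(A)\le n$ if and only if this system has no solution over $\overline{\mathbb{F}_2}$. If $n\ge R(A)$, then the minimal degree of a Nullstellensatz certificate for this system is at most $\tilde R_k(\mathcal P_n^1,\dots,\mathcal P_n^k;S_n)-1$. Moreover, the number of solutions of the system equals the number of $k$-colorings of $S_n$ such that for every color $c$, each set $X\in\mathcal P_n^c$ contains an element that is not assigned color $c$.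
   Context: A Ramsey-type problem is a triple $A=(\{S_n\},\{\mathcal P_n^c\};k)$ where $k$ is a positive integer, $\{S_n\}_{n\ge1}$ is a sequence of sets, and for each color $c\in[k]$ and each $n$, $\mathcal P_n^c$ is a family of subsets of $S_n$, such that: (i) $S_i\subseteq S_{i+1}$ for $i\ge1$; (ii) $\mathcal P_i^c\subseteq\mathcal P_{i+1}^c$ for $i\ge1$, $1\le c\le k$; (iii) there exists an integer $N$ such that for all $i\ge N$ and every $k$-coloring of $S_i$ there is a color $c$ and some $X\in\mathcal P_i^c$ all of whose elements have color $c$. The smallest such $N$ is the Ramsey-type number $R(A)$. A Nullstellensatz certificate for a system $f_1=\dots=f_m=0$ is a tuple of polynomials $\beta_1,\dots,\beta_m$ with $\sum\beta_i f_i=1$; its degree is the largest degree of the $\beta_i$. Builder–Painter game for fixed $n$: each turn Builder selects an element of $S_n$ and Painter assigns it a color in $[k]$; Builder wins once there is a color $c$ and $X\in\mathcal P_n^c$ all of whose elements are assigned color $c$. $\tilde R_k(\mathcal P_n^1,\dots,\mathcal P_n^k;S_n)$ is the smallest number of turns within which Builder is guaranteed a victory. *)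

theory Defs
  imports
    "HOL-Library.FuncSet"
    "HOL-Library.Equipollence"
    "HOL-Library.Poly_Mapping"
    "HOL-Library.Z2"
    "HOL-Algebra.Algebraic_Closure_Type"
begin

section \<open>Ramsey-type problems\<close>

text \<open>Colors are the elements of \<open>{1..k}\<close>; a \<open>k\<close>-coloring of \<open>A\<close> is an element of
  \<open>A \<rightarrow>\<^sub>E {1..k}\<close>. The families indexed by \<open>n\<close> and \<open>c\<close> are only
  relevant for \<open>n \<ge> 1\<close> and \<open>c \<in> {1..k}\<close>.\<close>

definition ramsey_from ::
  "nat \<Rightarrow> (nat \<Rightarrow> 's set) \<Rightarrow> (nat \<Rightarrow> nat \<Rightarrow> 's set set) \<Rightarrow> nat \<Rightarrow> bool"
  where "ramsey_from k S P N \<longleftrightarrow>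
    N \<ge> 1 \<and>
    (\<forall>i\<ge>N. \<forall>\<chi> \<in> S i \<rightarrow>\<^sub>E {1..k}. \<exists>c\<in>{1..k}. \<exists>T\<in>P i c. \<forall>x\<in>T. \<chi> x = c)"

definition ramsey_type_problem ::
  "nat \<Rightarrow> (nat \<Rightarrow> 's set) \<Rightarrow> (nat \<Rightarrow> nat \<Rightarrow> 's set set) \<Rightarrow> bool"
  where "ramsey_type_problem k S P \<longleftrightarrow>
    k \<ge> 1 \<and>
    (\<forall>n\<ge>1. \<forall>c\<in>{1..k}. P n c \<subseteq> Pow (S n)) \<and>
    (\<forall>i\<ge>1. S i \<subseteq> S (i + 1)) \<and>
    (\<forall>i\<ge>1. \<forall>c\<in>{1..k}. P i c \<subseteq> P (i + 1) c) \<and>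
    (\<exists>N. ramsey_from k S P N)"

definition ramsey_number ::
  "nat \<Rightarrow> (nat \<Rightarrow> 's set) \<Rightarrow> (nat \<Rightarrow> nat \<Rightarrow> 's set set) \<Rightarrow> nat"
  where "ramsey_number k S P = (LEAST N. ramsey_from k S P N)"

definition avoiding_colorings ::
  "nat \<Rightarrow> 's set \<Rightarrow> (nat \<Rightarrow> 's set set) \<Rightarrow> ('s \<Rightarrow> nat) set"
  where "avoiding_colorings k A Q =
    {\<chi> \<in> A \<rightarrow>\<^sub>E {1..k}. \<forall>c\<in>{1..k}. \<forall>T\<in>Q c. \<exists>s\<in>T. \<chi> s \<noteq> c}"


section \<open>The Builder-Painter game\<close>

text \<open>A position is the partial coloring built so far.\<close>

definition builder_won ::
  "nat \<Rightarrow> (nat \<Rightarrow> 's set set) \<Rightarrow> ('s \<rightharpoonup> nat) \<Rightarrow> bool"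
  where "builder_won k Q f \<longleftrightarrow> (\<exists>c\<in>{1..k}. \<exists>T\<in>Q c. \<forall>x\<in>T. f x = Some c)"

text \<open>\<open>builder_wins k A Q t f\<close>: from position \<open>f\<close>, Builder can force a win within at most
  \<open>t\<close> further turns. Builder only selects elements that have no color yet.\<close>

primrec builder_wins ::
  "nat \<Rightarrow> 's set \<Rightarrow> (nat \<Rightarrow> 's set set) \<Rightarrow> nat \<Rightarrow> ('s \<rightharpoonup> nat) \<Rightarrow> bool"
  where
    "builder_wins k A Q 0 f \<longleftrightarrow> builder_won k Q f"
  | "builder_wins k A Q (Suc t) f \<longleftrightarrow>
       builder_won k Q f \<or>
       (\<exists>s \<in> A - dom f. \<forall>c\<in>{1..k}. builder_wins k A Q t (f(s \<mapsto> c)))"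

text \<open>If Builder can force a win, this is 0 only in the degenerate case that some \<open>Q c\<close> contains the empty set; otherwise
  subtracting 1 from it does not truncate.\<close>

definition online_ramsey_number :: "nat \<Rightarrow> 's set \<Rightarrow> (nat \<Rightarrow> 's set set) \<Rightarrow> nat"
  where "online_ramsey_number k A Q = (LEAST t. builder_wins k A Q t Map.empty)"


section \<open>Multivariate polynomials and Nullstellensatz certificates\<close>

text \<open>A monomial maps each variable to its exponent; a polynomial maps each monomial to its
  coefficient. Both have finite support, and the ring operations are those of
  \<^typ>\<open>('v \<Rightarrow>\<^sub>0 nat) \<Rightarrow>\<^sub>0 'a\<close>.\<close>

type_synonym ('v, 'a) mpoly = "('v \<Rightarrow>\<^sub>0 nat) \<Rightarrow>\<^sub>0 'a"

definition mvar :: "'v \<Rightarrow> ('v, 'a::comm_ring_1) mpoly"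
  where "mvar v = Poly_Mapping.single (Poly_Mapping.single v 1) 1"

definition mpolys :: "'v set \<Rightarrow> ('v, 'a::comm_ring_1) mpoly set"
  where "mpolys V = {p. \<forall>m \<in> Poly_Mapping.keys p. Poly_Mapping.keys m \<subseteq> V}"

definition meval :: "('v \<Rightarrow> 'a) \<Rightarrow> ('v, 'a::comm_ring_1) mpoly \<Rightarrow> 'a"
  where "meval a p =
    (\<Sum>m \<in> Poly_Mapping.keys p.
       Poly_Mapping.lookup p m *
       (\<Prod>v \<in> Poly_Mapping.keys m. a v ^ Poly_Mapping.lookup m v))"

text \<open>Total degree; the zero polynomial gets degree 0.\<close>

definition total_degree :: "('v, 'a::comm_ring_1) mpoly \<Rightarrow> nat"
  where "total_degree p =
    Max (insert 0 ((\<lambda>m. \<Sum>v \<in> Poly_Mapping.keys m. Poly_Mapping.lookup m v) `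
                   Poly_Mapping.keys p))"

definition solutions :: "'v set \<Rightarrow> ('v, 'a::comm_ring_1) mpoly set \<Rightarrow> ('v \<Rightarrow> 'a) set"
  where "solutions V F = {a \<in> V \<rightarrow>\<^sub>E UNIV. \<forall>f\<in>F. meval a f = 0}"

text \<open>The system \<open>F\<close> is not required to be finite, so a certificate has, as a linear
  combination, only finitely many nonzero coefficients \<open>\<beta> f\<close>.\<close>

definition nullstellensatz_certificate ::
  "'v set \<Rightarrow> ('v, 'a::comm_ring_1) mpoly set \<Rightarrow>
   (('v, 'a) mpoly \<Rightarrow> ('v, 'a) mpoly) \<Rightarrow> bool"
  where "nullstellensatz_certificate V F \<beta> \<longleftrightarrow>
    (\<forall>f\<in>F. \<beta> f \<in> mpolys V) \<and>
    finite {f\<in>F. \<beta> f \<noteq> 0} \<and>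
    (\<Sum>f \<in> {f\<in>F. \<beta> f \<noteq> 0}. \<beta> f * f) = 1"

text \<open>The set below is nonempty and finite for every certificate.\<close>

definition certificate_degree ::
  "('v, 'a::comm_ring_1) mpoly set \<Rightarrow> (('v, 'a) mpoly \<Rightarrow> ('v, 'a) mpoly) \<Rightarrow> nat"
  where "certificate_degree F \<beta> = Max ((\<lambda>f. total_degree (\<beta> f)) ` {f\<in>F. \<beta> f \<noteq> 0})"

definition min_certificate_degree ::
  "'v set \<Rightarrow> ('v, 'a::comm_ring_1) mpoly set \<Rightarrow> nat"
  where "min_certificate_degree V F =
    (LEAST d. \<exists>\<beta>. nullstellensatz_certificate V F \<beta> \<and> certificate_degree F \<beta> = d)"


section \<open>The polynomial system of a Ramsey-type problem\<close>

text \<open>The pair \<open>(c, s)\<close> names the variable \<open>x\<^bsub>c,s\<^esub>\<close>.\<close>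

definition ramsey_vars :: "nat \<Rightarrow> 's set \<Rightarrow> (nat \<times> 's) set"
  where "ramsey_vars k A = {1..k} \<times> A"

definition ramsey_system ::
  "nat \<Rightarrow> 's set \<Rightarrow> (nat \<Rightarrow> 's set set) \<Rightarrow> (nat \<times> 's, bit alg_closure) mpoly set"
  where "ramsey_system k A Q =
    {(\<Prod>s\<in>T. mvar (c, s)) | T c. c \<in> {1..k} \<and> T \<in> Q c} \<union>
    {1 + (\<Sum>i=1..k. mvar (i, s)) | s. s \<in> A} \<union>
    {mvar (i, s) * mvar (j, s) | i j s. s \<in> A \<and> 1 \<le> i \<and> i < j \<and> j \<le> k}"

end

theory Submission
  imports Defs
begin

text \<open>An optimal strategy of Builder is turned into a certificate by descending its game tree from the
  root, whose monomial is 1. The monomial \<open>m\<close> of a position is the product of the \<open>x\<^bsub>c,s\<^esub>\<close> over the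
  elements \<open>s\<close> colored \<open>c\<close> so far. If Builder selects \<open>s\<close> there, then
  \<open>m = m * q\<^sub>s - (\<Sum>i. m * x\<^bsub>i,s\<^esub>)\<close>, whose last terms are the monomials of the successor positions;
  the monomial of a won position is a multiple of some \<open>p\<^bsub>X,c\<^esub>\<close>. The coefficients are monomials of
  positions that are not yet won, or proper divisors of monomials of won ones, so their degree is
  less than the number of turns. The equations \<open>u\<^bsub>i,j,s\<^esub>\<close> are only needed to count solutions.\<close>

section \<open>Evaluation and degree of multivariate polynomials\<close>

text \<open>A polynomial is built up by adjoining one new monomial at a time, so statements stable
  under sums, such as multiplicativity of \<open>meval\<close>, need a check on single terms
  only.\<close>

lemma mpoly_induct [case_names single add]:
  fixes p :: "('v, 'a::comm_ring_1) mpoly"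
  assumes "\<And>m c. Q (Poly_Mapping.single m c)"
    and "\<And>p q. Q p \<Longrightarrow> Q q \<Longrightarrow> Q (p + q)"
  shows "Q p"
proof (induction p rule: Poly_Mapping.update_induct)
  case const
  show ?case using assms(1)[of 0 0] by simp
next
  case (update f a b)
  have "Poly_Mapping.update a b f = f + Poly_Mapping.single a b"
    using update(1)
    by (intro poly_mapping_eqI)
      (auto simp: Poly_Mapping.lookup_update lookup_add lookup_single when_def not_in_keys_iff_lookup_eq_zero)
  then show ?case using update(3) assms by metis
qed

lemma meval_0 [simp]: "meval a 0 = 0"
  by (simp add: meval_def)

lemma meval_single:
  "meval a (Poly_Mapping.single m c) = c * (\<Prod>v\<in>Poly_Mapping.keys m. a v ^ Poly_Mapping.lookup m v)"
  by (cases "c = 0") (auto simp: meval_def)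

lemma meval_add: "meval a (p + q) = meval a p + meval a q"
  unfolding meval_def by (rule setsum_keys_plus_distrib) (auto simp: algebra_simps)

lemma meval_1 [simp]: "meval a 1 = 1"
  by (simp add: meval_single flip: single_one)

text \<open>Over the union of both supports the three products can be compared factor by factor: a
  variable outside a support has exponent 0 and contributes the factor 1.\<close>

lemma prod_keys_add:
  fixes a :: "'v \<Rightarrow> 'a::comm_ring_1" and m m' :: "'v \<Rightarrow>\<^sub>0 nat"
  shows "(\<Prod>v\<in>Poly_Mapping.keys (m + m'). a v ^ Poly_Mapping.lookup (m + m') v) =
    (\<Prod>v\<in>Poly_Mapping.keys m. a v ^ Poly_Mapping.lookup m v) *
    (\<Prod>v\<in>Poly_Mapping.keys m'. a v ^ Poly_Mapping.lookup m' v)"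
proof -
  let ?K = "Poly_Mapping.keys m \<union> Poly_Mapping.keys m'"
  have ext: "(\<Prod>v\<in>Poly_Mapping.keys l. a v ^ Poly_Mapping.lookup l v) =
      (\<Prod>v\<in>?K. a v ^ Poly_Mapping.lookup l v)" if "Poly_Mapping.keys l \<subseteq> ?K" for l
    using that by (intro prod.mono_neutral_left) (auto simp: in_keys_iff)
  show ?thesis
    unfolding ext[OF keys_add] ext[OF Un_upper1] ext[OF Un_upper2]
    by (simp add: lookup_add power_add prod.distrib)
qed

lemma meval_mult: "meval a (p * q) = meval a p * meval a q"
proof (induction p rule: mpoly_induct)
  case (single m c)
  show ?case
  proof (induction q rule: mpoly_induct)
    case (single m' c')
    show ?case by (simp add: mult_single meval_single prod_keys_add)
  qed (simp add: meval_add algebra_simps)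
qed (simp add: meval_add algebra_simps)

lemma meval_sum: "meval a (\<Sum>i\<in>I. f i) = (\<Sum>i\<in>I. meval a (f i))"
  by (induction I rule: infinite_finite_induct) (auto simp: meval_add)

lemma meval_prod: "meval a (\<Prod>i\<in>I. f i) = (\<Prod>i\<in>I. meval a (f i))"
  by (induction I rule: infinite_finite_induct) (auto simp: meval_mult)

lemma meval_mvar [simp]: "meval a (mvar v) = a v"
  by (simp add: mvar_def meval_single)

section \<open>Total degree of sums and products\<close>

lemma total_degree_le_iff:
  "total_degree p \<le> d \<longleftrightarrow>
    (\<forall>m\<in>Poly_Mapping.keys p. (\<Sum>v\<in>Poly_Mapping.keys m. Poly_Mapping.lookup m v) \<le> d)"
  unfolding total_degree_def by (subst Max_le_iff) auto

lemma total_degree_add_le: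
  "total_degree p \<le> d \<Longrightarrow> total_degree q \<le> d \<Longrightarrow> total_degree (p + q) \<le> d"
  unfolding total_degree_le_iff using keys_add[of p q] by blast

lemma total_degree_uminus [simp]: "total_degree (- p) = total_degree p"
  by (simp add: total_degree_def)

lemma sum_lookup_add:
  fixes m m' :: "'v \<Rightarrow>\<^sub>0 nat"
  shows "(\<Sum>v\<in>Poly_Mapping.keys (m + m'). Poly_Mapping.lookup (m + m') v) =
    (\<Sum>v\<in>Poly_Mapping.keys m. Poly_Mapping.lookup m v) +
    (\<Sum>v\<in>Poly_Mapping.keys m'. Poly_Mapping.lookup m' v)"
  by (rule setsum_keys_plus_distrib[where f = "\<lambda>_ x. x"]) auto

lemma total_degree_mult_le:
  assumes "total_degree p \<le> d" "total_degree q \<le> e"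
  shows "total_degree (p * q) \<le> d + e"
  unfolding total_degree_le_iff
proof
  fix m assume "m \<in> Poly_Mapping.keys (p * q)"
  then obtain a b where "m = a + b" "a \<in> Poly_Mapping.keys p" "b \<in> Poly_Mapping.keys q"
    using keys_mult[of p q] by blast
  with assms show "(\<Sum>v\<in>Poly_Mapping.keys m. Poly_Mapping.lookup m v) \<le> d + e"
    unfolding total_degree_le_iff by (auto simp: sum_lookup_add intro: add_mono)
qed

lemma total_degree_1 [simp]: "total_degree 1 = 0"
  by (simp add: total_degree_def)

lemma total_degree_mvar_le: "total_degree (mvar v) \<le> 1"
  by (simp add: total_degree_le_iff mvar_def)

lemma total_degree_prod_mvar_le: "total_degree (\<Prod>i\<in>I. mvar (g i)) \<le> card I"
proof (induction I rule: infinite_finite_induct)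
  case (insert i I)
  then show ?case
    using total_degree_mult_le[OF total_degree_mvar_le insert.IH, of "g i"] by simp
qed auto

section \<open>Polynomials in a given set of variables\<close>

lemma mpolys_0 [simp]: "0 \<in> mpolys V"
  and mpolys_1 [simp]: "1 \<in> mpolys V"
  by (auto simp: mpolys_def)

lemma mpolys_mvar: "v \<in> V \<Longrightarrow> mvar v \<in> mpolys V"
  by (auto simp: mpolys_def mvar_def)

lemma mpolys_uminus: "p \<in> mpolys V \<Longrightarrow> - p \<in> mpolys V"
  by (auto simp: mpolys_def)

lemma mpolys_add: "p \<in> mpolys V \<Longrightarrow> q \<in> mpolys V \<Longrightarrow> p + q \<in> mpolys V"
  using keys_add[of p q] by (auto simp: mpolys_def)

lemma mpolys_mult:
  assumes "p \<in> mpolys V" "q \<in> mpolys V"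
  shows "p * q \<in> mpolys V"
  unfolding mpolys_def mem_Collect_eq
proof
  fix m assume "m \<in> Poly_Mapping.keys (p * q)"
  then obtain a b where m: "m = a + b" and "a \<in> Poly_Mapping.keys p" "b \<in> Poly_Mapping.keys q"
    using keys_mult[of p q] by blast
  then have "Poly_Mapping.keys a \<subseteq> V" "Poly_Mapping.keys b \<subseteq> V"
    using assms by (simp_all add: mpolys_def)
  then show "Poly_Mapping.keys m \<subseteq> V"
    unfolding m using keys_add[of a b] by blast
qed

lemma mpolys_prod: "(\<And>i. i \<in> I \<Longrightarrow> f i \<in> mpolys V) \<Longrightarrow> (\<Prod>i\<in>I. f i) \<in> mpolys V"
  by (induction I rule: infinite_finite_induct) (auto intro: mpolys_mult)


section \<open>Combinations with coefficients of bounded degree\<close>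

text \<open>The same \<open>f\<close> may be added repeatedly, so closure under sums and negation
  follows by induction without collecting coefficients. The collecting is done once, in
  \<open>bounded_combinationD\<close>.\<close>

inductive bounded_combination ::
  "'v set \<Rightarrow> ('v, 'a::comm_ring_1) mpoly set \<Rightarrow> nat \<Rightarrow> ('v, 'a) mpoly \<Rightarrow> bool"
  for V F d where
  zero: "bounded_combination V F d 0"
| add_multiple: "bounded_combination V F d p \<Longrightarrow> f \<in> F \<Longrightarrow> h \<in> mpolys V \<Longrightarrow> total_degree h \<le> d
    \<Longrightarrow> bounded_combination V F d (p + h * f)"

lemma bounded_combination_multiple:
  "f \<in> F \<Longrightarrow> h \<in> mpolys V \<Longrightarrow> total_degree h \<le> d \<Longrightarrow> bounded_combination V F d (h * f)"
  using bounded_combination.add_multiple[OF bounded_combination.zero, of f F h V d] by simp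

lemma bounded_combination_add:
  assumes "bounded_combination V F d q" "bounded_combination V F d p"
  shows "bounded_combination V F d (p + q)"
  using assms
proof (induction rule: bounded_combination.induct)
  case (add_multiple q f h)
  then show ?case
    using bounded_combination.add_multiple[of V F d "p + q" f h] by (simp add: add.assoc)
qed simp

lemma bounded_combination_uminus:
  "bounded_combination V F d p \<Longrightarrow> bounded_combination V F d (- p)"
proof (induction rule: bounded_combination.induct)
  case (add_multiple p f h)
  then show ?case
    using bounded_combination.add_multiple[of V F d "- p" f "- h"] by (simp add: mpolys_uminus)
qed (simp add: bounded_combination.zero)

lemma bounded_combination_sum:
  "(\<And>i. i \<in> I \<Longrightarrow> bounded_combination V F d (g i)) \<Longrightarrow> bounded_combination V F d (\<Sum>i\<in>I. g i)"
  by (induction I rule: infinite_finite_induct)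
    (auto intro: bounded_combination.zero bounded_combination_add)

text \<open>Repeated multiples of one \<open>f\<close> are merged by adding their coefficients,
  which keeps the degree at most \<open>d\<close>.\<close>

lemma bounded_combinationD:
  assumes "bounded_combination V F d p"
  shows "\<exists>\<beta>. (\<forall>f\<in>F. \<beta> f \<in> mpolys V \<and> total_degree (\<beta> f) \<le> d) \<and>
    finite {f\<in>F. \<beta> f \<noteq> 0} \<and> (\<Sum>f \<in> {f\<in>F. \<beta> f \<noteq> 0}. \<beta> f * f) = p"
  using assms
proof (induction rule: bounded_combination.induct)
  case zero
  show ?case by (rule exI[of _ "\<lambda>_. 0"]) (simp add: total_degree_def)
next
  case (add_multiple p f h)
  then obtain \<beta> where \<beta>: "\<forall>f\<in>F. \<beta> f \<in> mpolys V \<and> total_degree (\<beta> f) \<le> d"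
    and fin: "finite {f\<in>F. \<beta> f \<noteq> 0}" and sum: "(\<Sum>f \<in> {f\<in>F. \<beta> f \<noteq> 0}. \<beta> f * f) = p"
    by blast
  define \<gamma> where "\<gamma> = \<beta>(f := \<beta> f + h)"
  \<comment> \<open>The new coefficient of \<open>f\<close> may cancel to 0, and the old one may
    have been 0. Both sums are therefore taken over a common finite set that contains both
    supports.\<close>
  define B where "B = insert f {f\<in>F. \<beta> f \<noteq> 0}"
  have [simp]: "finite B" and "f \<in> B" using fin unfolding B_def by blast+
  have sub: "{f\<in>F. \<gamma> f \<noteq> 0} \<subseteq> B" by (auto simp: B_def \<gamma>_def)
  have "(\<Sum>g \<in> {f\<in>F. \<gamma> f \<noteq> 0}. \<gamma> g * g) = (\<Sum>g\<in>B. \<gamma> g * g)"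
    using sub add_multiple.hyps \<open>finite B\<close> by (intro sum.mono_neutral_left) (simp_all, auto simp: B_def)
  also have "\<dots> = (\<Sum>g\<in>B. \<beta> g * g + (if g = f then h * f else 0))"
    by (intro sum.cong) (auto simp: \<gamma>_def algebra_simps)
  also have "\<dots> = (\<Sum>g\<in>B. \<beta> g * g) + h * f"
    using \<open>f \<in> B\<close> by (simp add: sum.distrib)
  also have "(\<Sum>g\<in>B. \<beta> g * g) = p"
    unfolding sum[symmetric] using add_multiple.hyps
    by (intro sum.mono_neutral_right) (simp_all, auto simp: B_def)
  finally have "(\<Sum>g \<in> {f\<in>F. \<gamma> f \<noteq> 0}. \<gamma> g * g) = p + h * f" .
  moreover have "\<forall>f\<in>F. \<gamma> f \<in> mpolys V \<and> total_degree (\<gamma> f) \<le> d"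
    using \<beta> add_multiple.hyps by (auto simp: \<gamma>_def intro: mpolys_add total_degree_add_le)
  ultimately show ?case
    using finite_subset[OF sub \<open>finite B\<close>] by blast
qed

lemma bounded_combination_one_certificate:
  assumes "bounded_combination V F d 1"
  shows "\<exists>\<beta>. nullstellensatz_certificate V F \<beta> \<and> certificate_degree F \<beta> \<le> d"
proof -
  obtain \<beta> where \<beta>: "\<forall>f\<in>F. \<beta> f \<in> mpolys V \<and> total_degree (\<beta> f) \<le> d"
    and fin: "finite {f\<in>F. \<beta> f \<noteq> 0}" and sum: "(\<Sum>f \<in> {f\<in>F. \<beta> f \<noteq> 0}. \<beta> f * f) = 1"
    using bounded_combinationD[OF assms] by blast
  \<comment> \<open>The degree is a \<open>Max\<close>, which is meaningful only over a nonempty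
    set; an empty sum could not be 1.\<close>
  have "{f\<in>F. \<beta> f \<noteq> 0} \<noteq> {}"
    using sum by (metis sum.empty zero_neq_one)
  then have "certificate_degree F \<beta> \<le> d"
    unfolding certificate_degree_def using \<beta> fin by (subst Max_le_iff) auto
  then show ?thesis
    using \<beta> fin sum unfolding nullstellensatz_certificate_def by blast
qed


section \<open>The Builder-Painter game\<close>

lemma builder_wins_SucI:
  "s \<in> A - dom f \<Longrightarrow> (\<And>c. c \<in> {1..k} \<Longrightarrow> builder_wins k A Q t (f(s \<mapsto> c)))
    \<Longrightarrow> builder_wins k A Q (Suc t) f"
  unfolding builder_wins.simps by blast

lemma builder_wins_mono_time:
  "builder_wins k A Q t f \<Longrightarrow> t \<le> t' \<Longrightarrow> builder_wins k A Q t' f"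
proof (induction t arbitrary: f t')
  case 0
  then show ?case by (cases t') auto
next
  case (Suc t)
  then obtain u where "t' = Suc u" "t \<le> u" by (cases t') auto
  with Suc.IH Suc.prems(1) show ?case by (metis builder_wins.simps(2))
qed

text \<open>Additional colored elements never hurt Builder, who keeps following the strategy for
  \<open>f\<close>. A turn at an element that \<open>g\<close> already colors is skipped, its color
  in \<open>g\<close> serving as Painter's answer; the condition on \<open>ran g\<close> makes this
  answer legal.\<close>

lemma builder_wins_extend:
  "builder_wins k A Q t f \<Longrightarrow> f \<subseteq>\<^sub>m g \<Longrightarrow> ran g \<subseteq> {1..k} \<Longrightarrow> builder_wins k A Q t g"
proof (induction t arbitrary: f g)
  case 0
  then show ?case
    unfolding builder_wins.simps builder_won_def map_le_def by (metis domI)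
next
  case (Suc t)
  consider "builder_won k Q f"
    | s where "s \<in> A - dom f" "\<forall>c\<in>{1..k}. builder_wins k A Q t (f(s \<mapsto> c))"
    using Suc.prems(1) by auto
  then show ?case
  proof cases
    case 1
    then have "builder_won k Q g"
      using Suc.prems(2) unfolding builder_won_def map_le_def by (metis domI)
    then show ?thesis by simp
  next
    case 2
    show ?thesis
    proof (cases "s \<in> dom g")
      case True
      then obtain c where c: "g s = Some c" by blast
      then have "c \<in> {1..k}" using Suc.prems(3) by (auto simp: ran_def)
      moreover have "f(s \<mapsto> c) \<subseteq>\<^sub>m g" using Suc.prems(2) c by (auto simp: map_le_def)
      ultimately have "builder_wins k A Q t g" using 2 Suc by blast
      then show ?thesis by (rule builder_wins_mono_time) simp
    next
      case False
      have "builder_wins k A Q t (g(s \<mapsto> c))" if "c \<in> {1..k}" for c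
      proof (rule Suc.IH)
        show "builder_wins k A Q t (f(s \<mapsto> c))" using 2 that by blast
        show "f(s \<mapsto> c) \<subseteq>\<^sub>m g(s \<mapsto> c)" using Suc.prems(2) by (auto simp: map_le_def)
        show "ran (g(s \<mapsto> c)) \<subseteq> {1..k}" using False Suc.prems(3) that by (auto simp: ran_def)
      qed
      then show ?thesis using False 2 by (intro builder_wins_SucI[of s]) auto
    qed
  qed
qed

section \<open>Compactness of the game on a possibly infinite board\<close>

text \<open>\<open>U\<close> is the union of the chain. A finite set sees only finitely many of its
  values, and these already occur together in one member of the chain.\<close>

lemma map_chain_upper_bound:
  fixes C :: "('s \<rightharpoonup> 'c) set"
  assumes chain: "\<And>f g. f \<in> C \<Longrightarrow> g \<in> C \<Longrightarrow> f \<subseteq>\<^sub>m g \<or> g \<subseteq>\<^sub>m f" and "C \<noteq> {}"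
  obtains U where "\<And>f. f \<in> C \<Longrightarrow> f \<subseteq>\<^sub>m U"
    and "\<And>D. finite D \<Longrightarrow> \<exists>f\<in>C. U |` D = f |` D"
proof -
  define U where "U s = (if \<exists>f\<in>C. s \<in> dom f then (SOME f. f \<in> C \<and> s \<in> dom f) s else None)" for s
  \<comment> \<open>The choice made in \<open>U\<close> is immaterial: members of a chain agree
    wherever both are defined.\<close>
  have U: "U s = f s" if "f \<in> C" "s \<in> dom f" for f s
  proof -
    define g where "g = (SOME f. f \<in> C \<and> s \<in> dom f)"
    have "g \<in> C \<and> s \<in> dom g" unfolding g_def by (rule someI[of _ f]) (use that in blast)
    with that chain[of f g] have "g s = f s" unfolding map_le_def by metis
    moreover have "U s = g s" using that by (auto simp: U_def g_def)
    ultimately show ?thesis by simp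
  qed
  then have le: "f \<subseteq>\<^sub>m U" if "f \<in> C" for f
    using that by (simp add: map_le_def)
  have "\<exists>f\<in>C. \<forall>s\<in>D. U s = f s" if "finite D" for D
    using that
  proof (induction D)
    case empty
    then show ?case using \<open>C \<noteq> {}\<close> by blast
  next
    case (insert s D)
    then obtain f where f: "f \<in> C" "\<forall>s\<in>D. U s = f s" by blast
    show ?case
    proof (cases "U s = None")
      case True
      then have "f s = None" using U[OF f(1)] by (metis domIff)
      with True f show ?thesis by (metis insertE)
    next
      case False
      then obtain g where g: "g \<in> C" "s \<in> dom g" by (auto simp: U_def split: if_splits)
      \<comment> \<open>The larger of \<open>f\<close> and \<open>g\<close> agrees with
        \<open>U\<close> on \<open>insert s D\<close>.\<close>
      from chain[OF f(1) g(1)] show ?thesis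
      proof
        assume "f \<subseteq>\<^sub>m g"
        \<comment> \<open>If \<open>f x\<close> is undefined, then so is \<open>U x\<close>, and
          hence also \<open>g x\<close>, since \<open>g\<close> is a submap of
          \<open>U\<close>.\<close>
        have "U x = g x" if "x \<in> D" for x
          using that f \<open>f \<subseteq>\<^sub>m g\<close> le[OF g(1)] by (metis domIff map_le_def)
        then show ?thesis using g U by auto
      next
        assume "g \<subseteq>\<^sub>m f"
        then show ?thesis using f g U[OF g] by (auto simp: map_le_def)
      qed
    qed
  qed
  then have "\<exists>f\<in>C. U |` D = f |` D" if "finite D" for D
    using that by (metis (no_types, lifting) ext restrict_map_def)
  with le that show thesis by blast
qed

text \<open>The set \<open>A\<close> may be infinite, so this is a compactness statement. A partial coloring none of
  whose finite restrictions is winning for Builder, and which is maximal with this property, colors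
  all of \<open>A\<close>: otherwise Builder could select an uncolored element.\<close>

lemma builder_wins_if_no_avoiding_coloring:
  assumes fin: "\<And>c T. c \<in> {1..k} \<Longrightarrow> T \<in> Q c \<Longrightarrow> finite T"
    and sub: "\<And>c T. c \<in> {1..k} \<Longrightarrow> T \<in> Q c \<Longrightarrow> T \<subseteq> A"
    and "avoiding_colorings k A Q = {}"
  shows "\<exists>t. builder_wins k A Q t Map.empty"
proof (rule ccontr)
  assume no_win: "\<nexists>t. builder_wins k A Q t Map.empty"
  \<comment> \<open>Asking only finite restrictions not to be winning lets the property pass to the
    union of a chain, as required by Zorn's lemma.\<close>
  define good where "good f \<longleftrightarrow> dom f \<subseteq> A \<and> ran f \<subseteq> {1..k} \<and>
    (\<forall>D. finite D \<longrightarrow> (\<nexists>t. builder_wins k A Q t (f |` D)))" for f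
  have "\<exists>m\<in>Collect good. \<forall>a\<in>Collect good. m \<subseteq>\<^sub>m a \<longrightarrow> a = m"
  proof (rule predicate_Zorn)
    show "partial_order_on (Collect good) (relation_of (\<subseteq>\<^sub>m) (Collect good))"
      by (rule partial_order_on_relation_ofI) (auto intro: map_le_trans map_le_antisym)
    fix C assume C: "C \<in> Chains (relation_of (\<subseteq>\<^sub>m) (Collect good))"
    then have good: "\<And>f. f \<in> C \<Longrightarrow> good f"
      and chain: "\<And>f g. f \<in> C \<Longrightarrow> g \<in> C \<Longrightarrow> f \<subseteq>\<^sub>m g \<or> g \<subseteq>\<^sub>m f"
      by (auto simp: Chains_def relation_of_def)
    show "\<exists>u\<in>Collect good. \<forall>a\<in>C. a \<subseteq>\<^sub>m u"
    proof (cases "C = {}")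
      case True
      have "good Map.empty" using no_win by (simp add: good_def)
      then show ?thesis using True by blast
    next
      case False
      obtain U where U: "\<And>f. f \<in> C \<Longrightarrow> f \<subseteq>\<^sub>m U"
        and res: "\<And>D. finite D \<Longrightarrow> \<exists>f\<in>C. U |` D = f |` D"
        using map_chain_upper_bound[OF chain False] by metis
      have val: "s \<in> A \<and> c \<in> {1..k}" if "U s = Some c" for s c
      proof -
        obtain f where "f \<in> C" "U |` {s} = f |` {s}" using res[of "{s}"] by auto
        then have "f s = Some c" using that by (metis restrict_in singletonI)
        then show ?thesis using good[OF \<open>f \<in> C\<close>] by (auto simp: good_def ran_def)
      qed
      have "good U"
        unfolding good_def
      proof (intro conjI allI impI)
        show "dom U \<subseteq> A" "ran U \<subseteq> {1..k}" using val by (auto simp: ran_def)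
        fix D :: "'a set" assume "finite D"
        then show "\<nexists>t. builder_wins k A Q t (U |` D)"
          using res[of D] good by (metis good_def)
      qed
      then show ?thesis using U by blast
    qed
  qed
  then obtain M where M: "good M" and max: "\<And>f. good f \<Longrightarrow> M \<subseteq>\<^sub>m f \<Longrightarrow> f = M" by blast
  have dom: "dom M \<subseteq> A" and ran: "ran M \<subseteq> {1..k}"
    and lose: "\<And>D t. finite D \<Longrightarrow> \<not> builder_wins k A Q t (M |` D)"
    using M by (auto simp: good_def)
  have "A \<subseteq> dom M"
  proof
    fix s assume s: "s \<in> A"
    show "s \<in> dom M"
    proof (rule ccontr)
      assume s': "s \<notin> dom M"
      \<comment> \<open>By maximality no extension of \<open>M\<close> at \<open>s\<close> is good,
        so each answer \<open>c\<close> of Painter has a finite restriction from which Builder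
        wins.\<close>
      have "\<exists>D t. finite D \<and> builder_wins k A Q t (M(s \<mapsto> c) |` D)" if c: "c \<in> {1..k}" for c
      proof -
        have "M \<subseteq>\<^sub>m M(s \<mapsto> c)" using s' by (auto simp: map_le_def)
        moreover have "M(s \<mapsto> c) \<noteq> M" using s' by (metis domI fun_upd_same)
        ultimately have "\<not> good (M(s \<mapsto> c))" using max by blast
        moreover have "dom (M(s \<mapsto> c)) \<subseteq> A" "ran (M(s \<mapsto> c)) \<subseteq> {1..k}"
          using dom ran s s' c by (auto simp: ran_def)
        ultimately show ?thesis unfolding good_def by blast
      qed
      then obtain D t where D: "\<And>c. c \<in> {1..k} \<Longrightarrow> finite (D c)"
        and t: "\<And>c. c \<in> {1..k} \<Longrightarrow> builder_wins k A Q (t c) (M(s \<mapsto> c) |` D c)"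
        by metis
      \<comment> \<open>As there are finitely many colors, one finite set and one number of turns
        serve all answers. Selecting \<open>s\<close> then wins from a finite restriction of
        \<open>M\<close>, which is impossible.\<close>
      define E where "E = (\<Union>c\<in>{1..k}. D c)"
      define u where "u = (\<Sum>c\<in>{1..k}. t c)"
      have "builder_wins k A Q u ((M |` E)(s \<mapsto> c))" if c: "c \<in> {1..k}" for c
      proof (rule builder_wins_extend)
        have "t c \<le> u" unfolding u_def using c by (intro member_le_sum) auto
        then show "builder_wins k A Q u (M(s \<mapsto> c) |` D c)"
          using t[OF c] builder_wins_mono_time by blast
        show "M(s \<mapsto> c) |` D c \<subseteq>\<^sub>m (M |` E)(s \<mapsto> c)"
          using c by (auto simp: map_le_def E_def restrict_map_def split: if_splits)
        show "ran ((M |` E)(s \<mapsto> c)) \<subseteq> {1..k}"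
          using c ran by (auto simp: ran_def restrict_map_def split: if_splits)
      qed
      then have "builder_wins k A Q (Suc u) (M |` E)"
        using s s' by (intro builder_wins_SucI[of s]) auto
      moreover have "finite E" using D by (simp add: E_def)
      ultimately show False using lose by blast
    qed
  qed
  with dom have dom: "dom M = A" by blast
  define \<chi> where "\<chi> = restrict (\<lambda>s. the (M s)) A"
  have "\<chi> \<in> A \<rightarrow>\<^sub>E {1..k}"
    using ran dom by (fastforce simp: \<chi>_def ran_def)
  then obtain c T where c: "c \<in> {1..k}" "T \<in> Q c" and mono: "\<forall>s\<in>T. \<chi> s = c"
    using assms(3) unfolding avoiding_colorings_def by blast
  have "(M |` T) s = Some c" if "s \<in> T" for s
    using that mono sub[OF c] dom by (fastforce simp: \<chi>_def)
  \<comment> \<open>The monochromatic \<open>T\<close> is finite, so this is one of the restrictions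
    covered by \<open>lose\<close>.\<close>
  then have "builder_wins k A Q 0 (M |` T)"
    using c unfolding builder_wins.simps builder_won_def by blast
  then show False using lose fin[OF c] by blast
qed


section \<open>From Builder's strategy to a certificate\<close>

lemma monochromatic_in_ramsey_system:
  "c \<in> {1..k} \<Longrightarrow> T \<in> Q c \<Longrightarrow> (\<Prod>s\<in>T. mvar (c, s)) \<in> ramsey_system k A Q"
  unfolding ramsey_system_def by blast

lemma covering_in_ramsey_system:
  "s \<in> A \<Longrightarrow> 1 + (\<Sum>i=1..k. mvar (i, s)) \<in> ramsey_system k A Q"
  unfolding ramsey_system_def by blast

text \<open>The monomial of the position is the product for a monochromatic \<open>T\<close> times
  the product over the remaining elements. As \<open>T\<close> is nonempty, this cofactor has degree
  below \<open>card (dom f)\<close>; this gains the 1 in the final bound.\<close>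

lemma bounded_combination_if_builder_won:
  assumes "builder_won k Q f"
    and "finite (dom f)" "dom f \<subseteq> A" "ran f \<subseteq> {1..k}" "card (dom f) \<le> Suc d"
    and "\<And>c. c \<in> {1..k} \<Longrightarrow> {} \<notin> Q c"
  shows "bounded_combination (ramsey_vars k A) (ramsey_system k A Q) d
    (\<Prod>s\<in>dom f. mvar (the (f s), s))"
proof -
  obtain c T where c: "c \<in> {1..k}" "T \<in> Q c" and T: "\<And>x. x \<in> T \<Longrightarrow> f x = Some c"
    using assms(1) unfolding builder_won_def by blast
  have sub: "T \<subseteq> dom f" using T by blast
  have fin: "finite T" using sub assms(2) by (rule finite_subset)
  have "T \<noteq> {}" using c assms(6) by blast
  then have "card T > 0" using fin by (simp add: card_gt_0_iff)
  then have card: "card (dom f - T) \<le> d"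
    using assms(5) by (simp add: card_Diff_subset[OF fin sub])
  have "(\<Prod>s\<in>dom f. mvar (the (f s), s)) =
      (\<Prod>s\<in>dom f - T. mvar (the (f s), s)) * (\<Prod>s\<in>T. mvar (the (f s), s))"
    by (rule prod.subset_diff[OF sub assms(2)])
  also have "(\<Prod>s\<in>T. mvar (the (f s), s)) = (\<Prod>s\<in>T. mvar (c, s))"
    by (rule prod.cong) (simp_all add: T)
  finally have eq: "(\<Prod>s\<in>dom f. mvar (the (f s), s)) =
      (\<Prod>s\<in>dom f - T. mvar (the (f s), s)) * (\<Prod>s\<in>T. mvar (c, s))" .
  show ?thesis
    unfolding eq
  proof (rule bounded_combination_multiple)
    show "(\<Prod>s\<in>T. mvar (c, s)) \<in> ramsey_system k A Q"
      using c by (rule monochromatic_in_ramsey_system)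
    show "(\<Prod>s\<in>dom f - T. mvar (the (f s), s)) \<in> mpolys (ramsey_vars k A)"
      using assms(3,4) by (intro mpolys_prod mpolys_mvar) (auto simp: ramsey_vars_def ran_def)
    show "total_degree (\<Prod>s\<in>dom f - T. mvar (the (f s), s)) \<le> d"
      using total_degree_prod_mvar_le card by (rule order.trans)
  qed
qed

lemma exclusive_in_ramsey_system:
  "s \<in> A \<Longrightarrow> i \<in> {1..k} \<Longrightarrow> j \<in> {1..k} \<Longrightarrow> i < j
    \<Longrightarrow> mvar (i, s) * mvar (j, s) \<in> ramsey_system k A Q"
  unfolding ramsey_system_def atLeastAtMost_iff by blast

text \<open>The number of colored elements plus the number of remaining turns stays constant along a
  play, so a single \<open>d\<close> serves the whole game tree.\<close>

lemma bounded_combination_if_builder_wins: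
  fixes f :: "'s \<rightharpoonup> nat"
  assumes "builder_wins k A Q t f"
    and "finite (dom f)" "dom f \<subseteq> A" "ran f \<subseteq> {1..k}"
    and "card (dom f) + t \<le> Suc d"
    and "\<And>c. c \<in> {1..k} \<Longrightarrow> {} \<notin> Q c"
  shows "bounded_combination (ramsey_vars k A) (ramsey_system k A Q) d
    (\<Prod>s\<in>dom f. mvar (the (f s), s))"
  using assms(1-5)
proof (induction t arbitrary: f)
  case (0 f)
  then show ?case using assms(6) by (intro bounded_combination_if_builder_won) auto
next
  case (Suc t f)
  let ?m = "\<lambda>f :: 's \<rightharpoonup> nat. \<Prod>s\<in>dom f. mvar (the (f s), s) :: (nat \<times> 's, bit alg_closure) mpoly"
  consider "builder_won k Q f"
    | s where "s \<in> A - dom f" "\<forall>c\<in>{1..k}. builder_wins k A Q t (f(s \<mapsto> c))"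
    using Suc.prems(1) by auto
  then show ?case
  proof cases
    case 1
    with Suc.prems show ?thesis using assms(6) by (intro bounded_combination_if_builder_won) auto
  next
    case 2
    have succ: "?m (f(s \<mapsto> i)) = ?m f * mvar (i, s)" for i
    proof -
      have "(\<Prod>x\<in>dom f. mvar (the ((f(s \<mapsto> i)) x), x)) = ?m f"
        using 2 by (intro prod.cong) auto
      then show ?thesis using 2 Suc.prems(2) by (simp add: mult.commute)
    qed
    have "bounded_combination (ramsey_vars k A) (ramsey_system k A Q) d (?m (f(s \<mapsto> i)))"
      if "i \<in> {1..k}" for i
    proof (rule Suc.IH)
      show "builder_wins k A Q t (f(s \<mapsto> i))" using 2 that by blast
      show "finite (dom (f(s \<mapsto> i)))" "dom (f(s \<mapsto> i)) \<subseteq> A"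
        using 2 Suc.prems(2,3) by simp_all
      show "ran (f(s \<mapsto> i)) \<subseteq> {1..k}"
        using that 2 Suc.prems(4) by (simp add: domIff)
      show "card (dom (f(s \<mapsto> i))) + t \<le> Suc d"
        using 2 Suc.prems(2,5) by simp
    qed
    then have "bounded_combination (ramsey_vars k A) (ramsey_system k A Q) d
        (- (\<Sum>i=1..k. ?m f * mvar (i, s)))"
      unfolding succ by (intro bounded_combination_uminus bounded_combination_sum)
    moreover have "bounded_combination (ramsey_vars k A) (ramsey_system k A Q) d
        (?m f * (1 + (\<Sum>i=1..k. mvar (i, s))))"
    proof (rule bounded_combination_multiple)
      show "1 + (\<Sum>i=1..k. mvar (i, s)) \<in> ramsey_system k A Q"
        using 2 by (intro covering_in_ramsey_system) auto
      show "?m f \<in> mpolys (ramsey_vars k A)"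
        using Suc.prems by (intro mpolys_prod mpolys_mvar) (auto simp: ramsey_vars_def ran_def)
      show "total_degree (?m f) \<le> d"
        \<comment> \<open>At least one turn remains here, so
          \<open>card (dom f) \<le> d\<close>.\<close>
        by (rule order.trans[OF total_degree_prod_mvar_le]) (use Suc.prems in simp)
    qed
    ultimately have "bounded_combination (ramsey_vars k A) (ramsey_system k A Q) d
        (?m f * (1 + (\<Sum>i=1..k. mvar (i, s))) + - (\<Sum>i=1..k. ?m f * mvar (i, s)))"
      by (rule bounded_combination_add)
    then show ?thesis by (simp add: distrib_left sum_distrib_left)
  qed
qed

lemma bounded_combination_one_if_builder_wins:
  assumes "builder_wins k A Q t Map.empty"
  shows "bounded_combination (ramsey_vars k A) (ramsey_system k A Q) (t - 1) 1"
proof (cases "\<exists>c\<in>{1..k}. {} \<in> Q c")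
  case True
  then obtain c where "c \<in> {1..k}" "{} \<in> Q c" by blast
  \<comment> \<open>The empty product is itself one of the polynomials, and the constant coefficient
    1 gives a certificate of degree 0.\<close>
  then have "1 \<in> ramsey_system k A Q"
    using monochromatic_in_ramsey_system[of c k "{}" Q A] by simp
  from bounded_combination_multiple[OF this mpolys_1] show ?thesis by simp
next
  case False
  then show ?thesis
    \<comment> \<open>The monomial of the empty position is 1. The bound
      \<open>t \<le> Suc (t - 1)\<close> holds for \<open>t = 0\<close> as well.\<close>
    using bounded_combination_if_builder_wins[OF assms, of "t - 1"] by auto
qed

lemma min_certificate_degree_le:
  assumes "bounded_combination V F d 1"
  shows "min_certificate_degree V F \<le> d"
proof -
  obtain \<beta> where \<beta>: "nullstellensatz_certificate V F \<beta>" "certificate_degree F \<beta> \<le> d"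
    using bounded_combination_one_certificate[OF assms] by blast
  have "min_certificate_degree V F \<le> certificate_degree F \<beta>"
    unfolding min_certificate_degree_def by (rule Least_le) (use \<beta>(1) in blast)
  with \<beta>(2) show ?thesis by simp
qed


section \<open>Solutions and avoiding colorings\<close>

text \<open>Characteristic 2 is carried over from \<open>bit\<close> by the embedding
  \<open>to_ac\<close>.\<close>

lemma one_plus_one_eq_0: "1 + 1 = (0 :: bit alg_closure)"
proof -
  have "to_ac (1 + 1 :: bit) = 0" by (subst to_ac_eq_0_iff) simp
  then show ?thesis by (simp only: to_ac_add to_ac_1)
qed

lemma one_plus_eq_0_iff: "1 + x = 0 \<longleftrightarrow> x = (1 :: bit alg_closure)"
  using add_left_cancel[of 1 x 1] by (simp only: one_plus_one_eq_0)

lemma solutions_ramsey_system_iff: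
  assumes "\<And>c T. c \<in> {1..k} \<Longrightarrow> T \<in> Q c \<Longrightarrow> finite T"
  shows "a \<in> solutions (ramsey_vars k A) (ramsey_system k A Q) \<longleftrightarrow>
    a \<in> {1..k} \<times> A \<rightarrow>\<^sub>E UNIV \<and>
    (\<forall>c\<in>{1..k}. \<forall>T\<in>Q c. \<exists>s\<in>T. a (c, s) = 0) \<and>
    (\<forall>s\<in>A. (\<Sum>i=1..k. a (i, s)) = 1) \<and>
    (\<forall>s\<in>A. \<forall>i\<in>{1..k}. \<forall>j\<in>{1..k}. i < j \<longrightarrow> a (i, s) = 0 \<or> a (j, s) = 0)"
proof -
  have "(\<forall>f\<in>ramsey_system k A Q. meval a f = 0) \<longleftrightarrow>
    (\<forall>c\<in>{1..k}. \<forall>T\<in>Q c. (\<Prod>s\<in>T. a (c, s)) = 0) \<and>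
    (\<forall>s\<in>A. 1 + (\<Sum>i=1..k. a (i, s)) = 0) \<and>
    (\<forall>s\<in>A. \<forall>i\<in>{1..k}. \<forall>j\<in>{1..k}. i < j \<longrightarrow> a (i, s) * a (j, s) = 0)"
    (is "?L \<longleftrightarrow> ?R")
  proof
    assume zero: ?L
    show ?R
    proof (intro conjI ballI impI)
      fix c T assume "c \<in> {1..k}" "T \<in> Q c"
      then have "meval a (\<Prod>s\<in>T. mvar (c, s)) = 0"
        by (intro bspec[OF zero] monochromatic_in_ramsey_system)
      then show "(\<Prod>s\<in>T. a (c, s)) = 0" by (simp add: meval_prod)
    next
      fix s assume "s \<in> A"
      then have "meval a (1 + (\<Sum>i=1..k. mvar (i, s))) = 0"
        by (intro bspec[OF zero] covering_in_ramsey_system)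
      then show "1 + (\<Sum>i=1..k. a (i, s)) = 0" by (simp add: meval_add meval_sum)
    next
      fix s i j assume "s \<in> A" "i \<in> {1..k}" "j \<in> {1..k}" "i < j"
      then have "meval a (mvar (i, s) * mvar (j, s)) = 0"
        by (intro bspec[OF zero] exclusive_in_ramsey_system)
      then show "a (i, s) * a (j, s) = 0" by (simp add: meval_mult)
    qed
  next
    assume ?R
    then show ?L
      unfolding ramsey_system_def
      by (elim conjE) (auto simp: meval_prod meval_add meval_sum meval_mult)
  qed
  \<comment> \<open>Finiteness of \<open>T\<close> matters: a product over an infinite set is 1 by
    convention, even if some factor vanishes.\<close>
  also have "(\<forall>c\<in>{1..k}. \<forall>T\<in>Q c. (\<Prod>s\<in>T. a (c, s)) = 0) \<longleftrightarrow>
      (\<forall>c\<in>{1..k}. \<forall>T\<in>Q c. \<exists>s\<in>T. a (c, s) = 0)"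
    by (intro ball_cong refl prod_zero_iff assms)
  finally show ?thesis
    by (simp add: solutions_def ramsey_vars_def one_plus_eq_0_iff)
qed

text \<open>The pairwise conditions leave at most one nonzero entry, which must then be the whole
  sum. This forces solutions over the algebraic closure to take only the values 0 and 1.\<close>

lemma indicator_if_sum_eq_1:
  fixes x :: "'i::linorder \<Rightarrow> 'a::idom"
  assumes "finite I" and sum: "(\<Sum>i\<in>I. x i) = 1"
    and prod: "\<And>i j. i \<in> I \<Longrightarrow> j \<in> I \<Longrightarrow> i < j \<Longrightarrow> x i = 0 \<or> x j = 0"
  shows "\<exists>c\<in>I. \<forall>i\<in>I. x i = of_bool (i = c)"
proof -
  obtain c where c: "c \<in> I" "x c \<noteq> 0"
    using sum by (metis sum.neutral zero_neq_one)
  have zero: "x i = 0" if "i \<in> I" "i \<noteq> c" for i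
    using that c prod by (metis linorder_neqE)
  have "(\<Sum>i\<in>I. x i) = (\<Sum>i\<in>{c}. x i)"
    using c zero assms(1) by (intro sum.mono_neutral_right) auto
  with sum zero c show ?thesis by auto
qed

text \<open>The indicator vector of a coloring. It is \<open>undefined\<close> away from the
  variables, as extensionality of points in \<open>solutions\<close> demands.\<close>

definition coloring_to_point :: "nat \<Rightarrow> 's set \<Rightarrow> ('s \<Rightarrow> nat) \<Rightarrow> nat \<times> 's \<Rightarrow> 'a::zero_neq_one"
  where "coloring_to_point k A \<chi> = (\<lambda>(c, s)\<in>{1..k} \<times> A. of_bool (c = \<chi> s))"

text \<open>Indicator vectors give the bijection; conversely, a solution gives \<open>s\<close> the
  unique color whose variable at \<open>s\<close> is nonzero. Equipollence also covers infinite
  \<open>A\<close>.\<close>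

lemma solutions_eqpoll_avoiding_colorings:
  fixes A :: "'s set"
  assumes fin: "\<And>c T. c \<in> {1..k} \<Longrightarrow> T \<in> Q c \<Longrightarrow> finite T"
    and sub: "\<And>c T. c \<in> {1..k} \<Longrightarrow> T \<in> Q c \<Longrightarrow> T \<subseteq> A"
  shows "solutions (ramsey_vars k A) (ramsey_system k A Q) \<approx> avoiding_colorings k A Q"
proof -
  have "bij_betw (coloring_to_point k A) (avoiding_colorings k A Q)
    (solutions (ramsey_vars k A) (ramsey_system k A Q))"
    unfolding bij_betw_def
  proof (intro conjI subset_antisym subsetI)
    show "inj_on (coloring_to_point k A :: _ \<Rightarrow> _ \<Rightarrow> bit alg_closure) (avoiding_colorings k A Q)"
    proof (rule inj_onI)
      fix \<chi> \<psi>
      assume mem: "\<chi> \<in> avoiding_colorings k A Q" "\<psi> \<in> avoiding_colorings k A Q"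
        and eq: "coloring_to_point k A \<chi> = (coloring_to_point k A \<psi> :: _ \<Rightarrow> bit alg_closure)"
      \<comment> \<open>At \<open>(\<chi> s, s)\<close> the first point has value 1, and the second
        has value 1 only if the colors agree.\<close>
      have "\<chi> s = \<psi> s" if "s \<in> A" for s
        using fun_cong[OF eq, of "(\<chi> s, s)"] that mem(1)
        by (auto simp: coloring_to_point_def avoiding_colorings_def PiE_iff split: if_splits)
      then show "\<chi> = \<psi>"
        using mem unfolding avoiding_colorings_def by (blast intro: PiE_ext)
    qed
  next
    fix a :: "nat \<times> 's \<Rightarrow> bit alg_closure"
    assume "a \<in> coloring_to_point k A ` avoiding_colorings k A Q"
    then obtain \<chi> where a: "a = coloring_to_point k A \<chi>"
      and \<chi>: "\<And>s. s \<in> A \<Longrightarrow> \<chi> s \<in> {1..k}"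
      and avoid: "\<And>c T. c \<in> {1..k} \<Longrightarrow> T \<in> Q c \<Longrightarrow> \<exists>s\<in>T. \<chi> s \<noteq> c"
      unfolding avoiding_colorings_def by blast
    have val: "a (c, s) = of_bool (c = \<chi> s)" if "c \<in> {1..k}" "s \<in> A" for c s
      using that by (simp add: a coloring_to_point_def)
    have "\<exists>s\<in>T. a (c, s) = 0" if "c \<in> {1..k}" "T \<in> Q c" for c T
      using avoid[OF that] sub[OF that] val[OF that(1)] by fastforce
    moreover have "(\<Sum>i=1..k. a (i, s)) = 1" if "s \<in> A" for s
    proof -
      have "(\<Sum>i=1..k. a (i, s)) = (\<Sum>i=1..k. if i = \<chi> s then 1 else 0)"
        using that by (intro sum.cong) (auto simp: val)
      then show ?thesis using \<chi>[OF that] by simp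
    qed
    moreover have "a \<in> {1..k} \<times> A \<rightarrow>\<^sub>E UNIV"
      by (auto simp: a coloring_to_point_def)
    ultimately show "a \<in> solutions (ramsey_vars k A) (ramsey_system k A Q)"
      by (subst solutions_ramsey_system_iff) (use fin val in auto)
  next
    fix a assume "a \<in> solutions (ramsey_vars k A) (ramsey_system k A Q)"
    then have ext: "a \<in> {1..k} \<times> A \<rightarrow>\<^sub>E UNIV"
      and zero: "\<And>c T. c \<in> {1..k} \<Longrightarrow> T \<in> Q c \<Longrightarrow> \<exists>s\<in>T. a (c, s) = 0"
      and sum: "\<And>s. s \<in> A \<Longrightarrow> (\<Sum>i=1..k. a (i, s)) = 1"
      and prod: "\<And>s i j. s \<in> A \<Longrightarrow> i \<in> {1..k} \<Longrightarrow> j \<in> {1..k} \<Longrightarrow> i < j \<Longrightarrow> a (i, s) = 0 \<or> a (j, s) = 0"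
      by (subst (asm) solutions_ramsey_system_iff; use fin in blast)+
    have "\<exists>c\<in>{1..k}. \<forall>i\<in>{1..k}. a (i, s) = of_bool (i = c)" if "s \<in> A" for s
      by (rule indicator_if_sum_eq_1) (use sum prod that in auto)
    then obtain \<chi> where \<chi>: "\<And>s. s \<in> A \<Longrightarrow> \<chi> s \<in> {1..k}"
      and val: "\<And>s i. s \<in> A \<Longrightarrow> i \<in> {1..k} \<Longrightarrow> a (i, s) = of_bool (i = \<chi> s)"
      by metis
    have "\<exists>s\<in>T. \<chi> s \<noteq> c" if "c \<in> {1..k}" "T \<in> Q c" for c T
      using zero[OF that] sub[OF that] val[OF _ that(1)] by fastforce
    then have "restrict \<chi> A \<in> avoiding_colorings k A Q"
      using \<chi> sub by (fastforce simp: avoiding_colorings_def)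
    moreover have "a = coloring_to_point k A (restrict \<chi> A)"
    proof (rule PiE_ext[OF ext])
      show "coloring_to_point k A (restrict \<chi> A) \<in> {1..k} \<times> A \<rightarrow>\<^sub>E UNIV"
        by (auto simp: coloring_to_point_def)
    qed (auto simp: coloring_to_point_def val)
    ultimately show "a \<in> coloring_to_point k A ` avoiding_colorings k A Q" by blast
  qed
  then show ?thesis using eqpoll_def eqpoll_sym by blast
qed


section \<open>The Ramsey-type number\<close>

lemma ramsey_type_problem_mono:
  assumes "ramsey_type_problem k S P" and "n \<ge> 1" and "n \<le> i"
  shows "S n \<subseteq> S i" and "c \<in> {1..k} \<Longrightarrow> P n c \<subseteq> P i c"
proof -
  have "S n \<subseteq> S i \<and> (c \<in> {1..k} \<longrightarrow> P n c \<subseteq> P i c)"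
    using \<open>n \<le> i\<close>
  proof (induction i rule: dec_induct)
    case (step i)
    then have "S i \<subseteq> S (i + 1) \<and> (c \<in> {1..k} \<longrightarrow> P i c \<subseteq> P (i + 1) c)"
      using assms(1,2) unfolding ramsey_type_problem_def by auto
    with step show ?case by auto
  qed simp
  then show "S n \<subseteq> S i" and "c \<in> {1..k} \<Longrightarrow> P n c \<subseteq> P i c" by auto
qed

text \<open>A single stage decides all later ones: a coloring of \<open>S i\<close> restricts to
  \<open>S n\<close>, and a monochromatic set found there still belongs to \<open>P i c\<close> by
  monotonicity.\<close>

lemma ramsey_number_le_iff:
  assumes R: "ramsey_type_problem k S P" and n: "n \<ge> 1"
  shows "ramsey_number k S P \<le> n \<longleftrightarrow> avoiding_colorings k (S n) (P n) = {}"
proof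
  assume le: "ramsey_number k S P \<le> n"
  have "ramsey_from k S P (ramsey_number k S P)"
    unfolding ramsey_number_def using R by (auto simp: ramsey_type_problem_def intro: LeastI_ex)
  with le have mono: "\<And>\<chi>. \<chi> \<in> S n \<rightarrow>\<^sub>E {1..k} \<Longrightarrow> \<exists>c\<in>{1..k}. \<exists>T\<in>P n c. \<forall>x\<in>T. \<chi> x = c"
    by (simp add: ramsey_from_def)
  show "avoiding_colorings k (S n) (P n) = {}"
  proof (rule equals0I)
    fix \<chi> assume "\<chi> \<in> avoiding_colorings k (S n) (P n)"
    then have "\<chi> \<in> S n \<rightarrow>\<^sub>E {1..k}" "\<forall>c\<in>{1..k}. \<forall>T\<in>P n c. \<exists>s\<in>T. \<chi> s \<noteq> c"
      by (simp_all add: avoiding_colorings_def)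
    with mono[of \<chi>] show False by metis
  qed
next
  assume empty: "avoiding_colorings k (S n) (P n) = {}"
  have "\<exists>c\<in>{1..k}. \<exists>T\<in>P i c. \<forall>x\<in>T. \<chi> x = c"
    if "n \<le> i" and \<chi>: "\<chi> \<in> S i \<rightarrow>\<^sub>E {1..k}" for i \<chi>
  proof -
    have "restrict \<chi> (S n) \<in> S n \<rightarrow>\<^sub>E {1..k}"
      using \<chi> ramsey_type_problem_mono(1)[OF R n \<open>n \<le> i\<close>] by fastforce
    then obtain c T where c: "c \<in> {1..k}" "T \<in> P n c" "\<forall>x\<in>T. restrict \<chi> (S n) x = c"
      using empty unfolding avoiding_colorings_def by blast
    moreover have "T \<subseteq> S n"
      using R n c unfolding ramsey_type_problem_def by blast
    ultimately have "\<forall>x\<in>T. \<chi> x = c" by (metis restrict_apply' subsetD)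
    with c ramsey_type_problem_mono(2)[OF R n \<open>n \<le> i\<close>] show ?thesis by blast
  qed
  then have "ramsey_from k S P n" using n by (simp add: ramsey_from_def)
  then show "ramsey_number k S P \<le> n" unfolding ramsey_number_def by (rule Least_le)
qed

theorem theorem3:
  fixes k n :: nat
    and S :: "nat \<Rightarrow> 's set"
    and P :: "nat \<Rightarrow> nat \<Rightarrow> 's set set"
  assumes "ramsey_type_problem k S P"
    and "n \<ge> 1"
    and "\<And>c T. c \<in> {1..k} \<Longrightarrow> T \<in> P n c \<Longrightarrow> finite T"
  shows "(ramsey_number k S P \<le> n \<longleftrightarrow>
            solutions (ramsey_vars k (S n)) (ramsey_system k (S n) (P n)) = {})
       \<and> (n \<ge> ramsey_number k S P \<longrightarrow>
            (\<exists>\<beta>. nullstellensatz_certificate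
                    (ramsey_vars k (S n)) (ramsey_system k (S n) (P n)) \<beta>)
          \<and> (\<exists>t. builder_wins k (S n) (P n) t Map.empty)
          \<and> min_certificate_degree (ramsey_vars k (S n)) (ramsey_system k (S n) (P n))
              \<le> online_ramsey_number k (S n) (P n) - 1)
       \<and> solutions (ramsey_vars k (S n)) (ramsey_system k (S n) (P n))
            \<approx> avoiding_colorings k (S n) (P n)"
proof -
  let ?V = "ramsey_vars k (S n)" and ?F = "ramsey_system k (S n) (P n)"
  have sub: "\<And>c T. c \<in> {1..k} \<Longrightarrow> T \<in> P n c \<Longrightarrow> T \<subseteq> S n"
    using assms(1,2) unfolding ramsey_type_problem_def by blast
  have eqpoll: "solutions ?V ?F \<approx> avoiding_colorings k (S n) (P n)"
    by (rule solutions_eqpoll_avoiding_colorings) (use assms(3) sub in blast)+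
  then have "solutions ?V ?F = {} \<longleftrightarrow> avoiding_colorings k (S n) (P n) = {}"
    by (metis eqpoll_empty_iff_empty eqpoll_sym)
  then have iff: "ramsey_number k S P \<le> n \<longleftrightarrow> solutions ?V ?F = {}"
    using ramsey_number_le_iff[OF assms(1,2)] by simp
  have "(\<exists>\<beta>. nullstellensatz_certificate ?V ?F \<beta>)
      \<and> (\<exists>t. builder_wins k (S n) (P n) t Map.empty)
      \<and> min_certificate_degree ?V ?F \<le> online_ramsey_number k (S n) (P n) - 1"
    if "ramsey_number k S P \<le> n"
  proof -
    have "avoiding_colorings k (S n) (P n) = {}"
      using that ramsey_number_le_iff[OF assms(1,2)] by simp
    then have wins: "\<exists>t. builder_wins k (S n) (P n) t Map.empty"
      by (intro builder_wins_if_no_avoiding_coloring) (use assms(3) sub in blast)+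
    \<comment> \<open>Compactness supplies some winning number of turns, so the least one is
      attained and its strategy can be turned into a certificate.\<close>
    then have "builder_wins k (S n) (P n) (online_ramsey_number k (S n) (P n)) Map.empty"
      unfolding online_ramsey_number_def by (rule LeastI_ex)
    from bounded_combination_one_if_builder_wins[OF this] wins show ?thesis
      using bounded_combination_one_certificate min_certificate_degree_le by blast
  qed
  with iff eqpoll show ?thesis by blast
qed

end
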